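(* Let $\tau$ be a regular profinite tree set, let $\overline{\mathcal O}$ be the set of all splitting consistent orientations of $\tau$, and let $\varphi\colon\tau\to\mathcal B(\overline{\mathcal O})$ be the map $\varphi(\vec s):=(\overline{\mathcal O}(\overleftarrow s),\overline{\mathcal O}(\vec s))$, where $\overline{\mathcal O}(\vec s):=\{O\in\overline{\mathcal O}\mid\vec s\in O\}$. Then $\varphi$ is an isomorphism of tree sets between $\tau$ and its image in $\mathcal B(\overline{\mathcal O})$.
   Context: A separation system $(\vec S,\le,{}^* )$ is a poset with an order-reversing involution $\vec s\mapsto\overleftarrow s$; $s=\{\vec s,\overleftarrow s\}$ is the unoriented separation. $\vec s$ is degenerate if $\vec s=\overleftarrow s$, small if $\vec s\le\overleftarrow s$; a separation system is regular if it has no small element. Unoriented $r,s$ are nested if some orientation of $r$ is $\le$ some orientation of $s$. $\vec r$ is trivial if there is $s$ with $\vec r<\vec s$ and $\vec r<\overleftarrow s$ (strictly). A tree set is a separation system in which any two separations are nested and which has no degenerate and no trivial elements. An orientation is a set $O$ containing exactly one orientation of every unoriented separation; it is consistent if there are no $\vec r,\vec s\in O$ with $r\ne s$ and $\overleftarrow r\le\vec s$. A consistent orientation $O$ is splitting if every element of $O$ lies below some maximal element of $O$. For a set $X$, $\mathcal B(X)$ is the separation system of all ordered pairs $(A,B)$ with $A,B$ non-empty, $A\cap B=\emptyset$, $A\cup B=X$, ordered by $(A,B)\le(C,D)$ iff $A\subseteq C$ (equivalently $D\subseteq B$), with involution $(A,B)^*=(B,A)$. Homomorphisms commute with the involutions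 and preserve $\le$; an isomorphism is a bijective homomorphism whose inverse is a homomorphism. An inverse system of finite separation systems is a family $(\vec S_p)_{p\in P}$ over a directed poset $P$ with homomorphisms $f_{qp}\colon\vec S_q\to\vec S_p$ ($p\le q$), $f_{pp}=\mathrm{id}$, $f_{qp}f_{tq}=f_{tp}$; its inverse limit is the set of compatible families $(\vec s_p)$ with coordinatewise order and involution. A tree set is profinite if it is isomorphic to such an inverse limit. *)

theory Defs
  imports Main "HOL-Library.FuncSet"
begin

section \<open>Separation systems and tree sets\<close>

definition poset_on :: "'a set \<Rightarrow> ('a \<Rightarrow> 'a \<Rightarrow> bool) \<Rightarrow> bool" where
  "poset_on A R \<longleftrightarrow> reflp_on A R \<and> antisymp_on A R \<and> transp_on A R"

text \<open>Order and involution matter only on the carrier.\<close>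

record 'a sep_system =
  carrier :: "'a set"
  sep_le :: "'a \<Rightarrow> 'a \<Rightarrow> bool"  (infix "\<sqsubseteq>\<index>" 50)
  sep_inv :: "'a \<Rightarrow> 'a"  ("\<iota>\<index>")

locale separation_system =
  fixes S (structure)
  assumes poset: "poset_on (carrier S) (\<sqsubseteq>)"
    and inv_closed: "s \<in> carrier S \<Longrightarrow> \<iota> s \<in> carrier S"
    and inv_inv: "s \<in> carrier S \<Longrightarrow> \<iota> (\<iota> s) = s"
    and inv_antimono: "\<lbrakk>r \<in> carrier S; s \<in> carrier S; r \<sqsubseteq> s\<rbrakk> \<Longrightarrow> \<iota> s \<sqsubseteq> \<iota> r"

text \<open>Unoriented separations are represented by the two-element (or, if degenerate,
  one-element) sets of their orientations.\<close>

definition unoriented :: "'a sep_system \<Rightarrow> 'a \<Rightarrow> 'a set" where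
  "unoriented S s = {s, sep_inv S s}"

definition degenerate :: "'a sep_system \<Rightarrow> 'a \<Rightarrow> bool" where
  "degenerate S s \<longleftrightarrow> s = sep_inv S s"

definition small :: "'a sep_system \<Rightarrow> 'a \<Rightarrow> bool" where
  "small S s \<longleftrightarrow> s \<sqsubseteq>\<^bsub>S\<^esub> sep_inv S s"

definition regular :: "'a sep_system \<Rightarrow> bool" where
  "regular S \<longleftrightarrow> (\<forall>s\<in>carrier S. \<not> small S s)"

definition nested :: "'a sep_system \<Rightarrow> 'a \<Rightarrow> 'a \<Rightarrow> bool" where
  "nested S r s \<longleftrightarrow> (\<exists>r'\<in>unoriented S r. \<exists>s'\<in>unoriented S s. r' \<sqsubseteq>\<^bsub>S\<^esub> s')"

definition sep_less :: "'a sep_system \<Rightarrow> 'a \<Rightarrow> 'a \<Rightarrow> bool" where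
  "sep_less S r s \<longleftrightarrow> r \<sqsubseteq>\<^bsub>S\<^esub> s \<and> r \<noteq> s"

definition trivial :: "'a sep_system \<Rightarrow> 'a \<Rightarrow> bool" where
  "trivial S r \<longleftrightarrow> (\<exists>s\<in>carrier S. sep_less S r s \<and> sep_less S r (sep_inv S s))"

locale tree_set = separation_system +
  assumes all_nested: "\<lbrakk>r \<in> carrier S; s \<in> carrier S\<rbrakk> \<Longrightarrow> nested S r s"
    and not_degenerate: "s \<in> carrier S \<Longrightarrow> \<not> degenerate S s"
    and not_trivial: "s \<in> carrier S \<Longrightarrow> \<not> trivial S s"

section \<open>Homomorphisms\<close>

definition sep_hom :: "'a sep_system \<Rightarrow> 'b sep_system \<Rightarrow> ('a \<Rightarrow> 'b) \<Rightarrow> bool" where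
  "sep_hom S T f \<longleftrightarrow>
     f \<in> carrier S \<rightarrow> carrier T \<and>
     (\<forall>s\<in>carrier S. f (sep_inv S s) = sep_inv T (f s)) \<and>
     (\<forall>r\<in>carrier S. \<forall>s\<in>carrier S. r \<sqsubseteq>\<^bsub>S\<^esub> s \<longrightarrow> f r \<sqsubseteq>\<^bsub>T\<^esub> f s)"

definition sep_iso :: "'a sep_system \<Rightarrow> 'b sep_system \<Rightarrow> ('a \<Rightarrow> 'b) \<Rightarrow> bool" where
  "sep_iso S T f \<longleftrightarrow>
     bij_betw f (carrier S) (carrier T) \<and> sep_hom S T f \<and> sep_hom T S (inv_into (carrier S) f)"

definition tree_set_iso :: "'a sep_system \<Rightarrow> 'b sep_system \<Rightarrow> ('a \<Rightarrow> 'b) \<Rightarrow> bool" where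
  "tree_set_iso S T f \<longleftrightarrow> tree_set S \<and> tree_set T \<and> sep_iso S T f"

section \<open>Profinite tree sets\<close>

text \<open>Non-emptiness of the index poset is not demanded: the limit of the empty system has a
  degenerate element, so it is never a tree set.\<close>

definition directed_poset :: "'p set \<Rightarrow> ('p \<Rightarrow> 'p \<Rightarrow> bool) \<Rightarrow> bool" where
  "directed_poset P R \<longleftrightarrow> poset_on P R \<and> (\<forall>p\<in>P. \<forall>q\<in>P. \<exists>t\<in>P. R p t \<and> R q t)"

text \<open>The bonding map \<open>f q p\<close> goes from \<open>S q\<close> to \<open>S p\<close>, for \<open>R p q\<close>.\<close>

definition finite_inverse_system ::
  "'p set \<Rightarrow> ('p \<Rightarrow> 'p \<Rightarrow> bool) \<Rightarrow> ('p \<Rightarrow> 'b sep_system) \<Rightarrow> ('p \<Rightarrow> 'p \<Rightarrow> 'b \<Rightarrow> 'b) \<Rightarrow> bool" where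
  "finite_inverse_system P R S f \<longleftrightarrow>
     directed_poset P R \<and>
     (\<forall>p\<in>P. separation_system (S p) \<and> finite (carrier (S p))) \<and>
     (\<forall>p\<in>P. \<forall>q\<in>P. R p q \<longrightarrow> sep_hom (S q) (S p) (f q p)) \<and>
     (\<forall>p\<in>P. \<forall>s\<in>carrier (S p). f p p s = s) \<and>
     (\<forall>p\<in>P. \<forall>q\<in>P. \<forall>t\<in>P. R p q \<longrightarrow> R q t \<longrightarrow>
        (\<forall>s\<in>carrier (S t). f q p (f t q s) = f t p s))"

definition inverse_limit ::
  "'p set \<Rightarrow> ('p \<Rightarrow> 'p \<Rightarrow> bool) \<Rightarrow> ('p \<Rightarrow> 'b sep_system) \<Rightarrow> ('p \<Rightarrow> 'p \<Rightarrow> 'b \<Rightarrow> 'b)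
     \<Rightarrow> ('p \<Rightarrow> 'b) sep_system" where
  "inverse_limit P R S f =
     \<lparr>carrier = {s \<in> \<Pi>\<^sub>E p\<in>P. carrier (S p). \<forall>p\<in>P. \<forall>q\<in>P. R p q \<longrightarrow> f q p (s q) = s p},
      sep_le = (\<lambda>r s. \<forall>p\<in>P. r p \<sqsubseteq>\<^bsub>S p\<^esub> s p),
      sep_inv = (\<lambda>s. \<lambda>p\<in>P. sep_inv (S p) (s p))\<rparr>"

text \<open>HOL cannot quantify existentially over types, so the index type \<open>'p\<close> and the common
  element type \<open>'b\<close> of the finite systems are parameters. In a hypothesis of a theorem in
  which \<open>'p\<close> and \<open>'b\<close> are type variables occurring nowhere else, they are universally
  quantified, so any index poset and any finite systems are admitted. A common element type
  is no restriction, as every finite system has a copy in any infinite type.\<close>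

definition profinite :: "'p itself \<Rightarrow> 'b itself \<Rightarrow> 'a sep_system \<Rightarrow> bool" where
  "profinite tp tb \<tau> \<longleftrightarrow>
     (\<exists>(P :: 'p set) R (S :: 'p \<Rightarrow> 'b sep_system) f h.
        finite_inverse_system P R S f \<and> sep_iso \<tau> (inverse_limit P R S f) h)"

section \<open>Orientations\<close>

definition orientation :: "'a sep_system \<Rightarrow> 'a set \<Rightarrow> bool" where
  "orientation S ori \<longleftrightarrow>
     ori \<subseteq> carrier S \<and> (\<forall>s\<in>carrier S. \<exists>!s'. s' \<in> unoriented S s \<and> s' \<in> ori)"

definition consistent :: "'a sep_system \<Rightarrow> 'a set \<Rightarrow> bool" where
  "consistent S ori \<longleftrightarrow>
     \<not> (\<exists>r\<in>ori. \<exists>s\<in>ori. unoriented S r \<noteq> unoriented S s \<and> sep_inv S r \<sqsubseteq>\<^bsub>S\<^esub> s)"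

definition maximal_in :: "'a sep_system \<Rightarrow> 'a set \<Rightarrow> 'a \<Rightarrow> bool" where
  "maximal_in S A m \<longleftrightarrow> m \<in> A \<and> (\<forall>s\<in>A. \<not> sep_less S m s)"

definition splitting :: "'a sep_system \<Rightarrow> 'a set \<Rightarrow> bool" where
  "splitting S ori \<longleftrightarrow> (\<forall>s\<in>ori. \<exists>m. maximal_in S ori m \<and> s \<sqsubseteq>\<^bsub>S\<^esub> m)"

definition splitting_orientations :: "'a sep_system \<Rightarrow> 'a set set" where
  "splitting_orientations S = {ori. orientation S ori \<and> consistent S ori \<and> splitting S ori}"

definition splitting_orientations_at :: "'a sep_system \<Rightarrow> 'a \<Rightarrow> 'a set set" where
  "splitting_orientations_at S s = {ori \<in> splitting_orientations S. s \<in> ori}"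

section \<open>Bipartitions\<close>

definition bipartitions :: "'x set \<Rightarrow> ('x set \<times> 'x set) sep_system" where
  "bipartitions X =
     \<lparr>carrier = {(A, B). A \<noteq> {} \<and> B \<noteq> {} \<and> A \<inter> B = {} \<and> A \<union> B = X},
      sep_le = (\<lambda>(A, B) (C, D). A \<subseteq> C),
      sep_inv = (\<lambda>(A, B). (B, A))\<rparr>"

lemma separation_system_bipartitions: "separation_system (bipartitions X)"
  by unfold_locales
    (auto simp: bipartitions_def poset_on_def reflp_on_def antisymp_on_def transp_on_def)

definition induced :: "'a sep_system \<Rightarrow> 'a set \<Rightarrow> 'a sep_system" where
  "induced S A = S\<lparr>carrier := A\<rparr>"

definition bipartition_map :: "'a sep_system \<Rightarrow> 'a \<Rightarrow> 'a set set \<times> 'a set set" where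
  "bipartition_map S s =
     (splitting_orientations_at S (sep_inv S s), splitting_orientations_at S s)"

end

theory Submission
  imports Defs
begin

text \<open>
  The substance is that distinct separations are told apart by splitting orientations: whenever
  \<open>\<iota> a \<sqsubseteq> b\<close> fails, some splitting consistent orientation contains both \<open>a\<close> and \<open>b\<close>. In an
  inverse limit of finite systems every non-empty chain has a supremum, computed coordinatewise as
  a maximum that is attained, so by Zorn's lemma every element lies below a maximal one. This
  settles the case of comparable \<open>a\<close> and \<open>b\<close>, since the down-set of a maximal element is a splitting
  orientation. Otherwise \<open>a\<close> lies strictly below \<open>\<iota> b\<close>, and the interval between them is a chain.
  Some coordinate separates its endpoints, and the supremum \<open>c\<close> of the elements that agree with
  \<open>a\<close> there and the infimum \<open>d\<close> of the others form a jump of that chain. The edges \<open>c\<close> and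
  \<open>\<iota> d\<close> then point to a common node, and orienting everything towards this node is
  splitting.
\<close>

section \<open>Order and chains in regular tree sets\<close>

definition chain_in :: "'a sep_system \<Rightarrow> 'a set \<Rightarrow> bool" where
  "chain_in S C \<longleftrightarrow> C \<subseteq> carrier S \<and> (\<forall>x\<in>C. \<forall>y\<in>C. x \<sqsubseteq>\<^bsub>S\<^esub> y \<or> y \<sqsubseteq>\<^bsub>S\<^esub> x)"

definition supremum_in :: "'a sep_system \<Rightarrow> 'a set \<Rightarrow> 'a \<Rightarrow> bool" where
  "supremum_in S C u \<longleftrightarrow> u \<in> carrier S \<and> (\<forall>x\<in>C. x \<sqsubseteq>\<^bsub>S\<^esub> u) \<and>
     (\<forall>v\<in>carrier S. (\<forall>x\<in>C. x \<sqsubseteq>\<^bsub>S\<^esub> v) \<longrightarrow> u \<sqsubseteq>\<^bsub>S\<^esub> v)"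

context separation_system
begin

lemma le_refl: "x \<in> carrier S \<Longrightarrow> x \<sqsubseteq> x"
  using poset by (auto simp: poset_on_def reflp_on_def)

lemma le_antisym: "\<lbrakk>x \<sqsubseteq> y; y \<sqsubseteq> x; x \<in> carrier S; y \<in> carrier S\<rbrakk> \<Longrightarrow> x = y"
  using poset by (auto simp: poset_on_def antisymp_on_def)

lemma le_trans:
  "\<lbrakk>x \<sqsubseteq> y; y \<sqsubseteq> z; x \<in> carrier S; y \<in> carrier S; z \<in> carrier S\<rbrakk> \<Longrightarrow> x \<sqsubseteq> z"
  using poset unfolding poset_on_def transp_on_def by blast

lemma inv_le_iff:
  assumes "x \<in> carrier S" "y \<in> carrier S"
  shows "\<iota> x \<sqsubseteq> y \<longleftrightarrow> \<iota> y \<sqsubseteq> x" and "x \<sqsubseteq> \<iota> y \<longleftrightarrow> y \<sqsubseteq> \<iota> x" and "\<iota> x \<sqsubseteq> \<iota> y \<longleftrightarrow> y \<sqsubseteq> x"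
  using assms inv_antimono inv_closed inv_inv by metis+

end

locale regular_tree_set = tree_set +
  assumes regular: "regular S"
begin

lemma unoriented_eq_iff:
  assumes "x \<in> carrier S" "y \<in> carrier S"
  shows "unoriented S x = unoriented S y \<longleftrightarrow> x = y \<or> x = \<iota> y"
  using assms inv_inv by (auto simp: unoriented_def doubleton_eq_iff)

text \<open>The third condition is consistency without the exception for two orientations of the
  same separation. Taking \<open>y\<close> to be \<open>\<iota> x\<close> shows that no separation
  is oriented both ways.\<close>

lemma orientationI:
  assumes "ori \<subseteq> carrier S"
    and "\<And>x. x \<in> carrier S \<Longrightarrow> x \<in> ori \<or> \<iota> x \<in> ori"
    and "\<And>x y. \<lbrakk>x \<in> ori; y \<in> ori\<rbrakk> \<Longrightarrow> \<not> \<iota> x \<sqsubseteq> y"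
  shows "orientation S ori" and "consistent S ori"
proof -
  have "\<not> (x \<in> ori \<and> \<iota> x \<in> ori)" for x
    using assms(1,3) inv_closed le_refl by blast
  then show "orientation S ori"
    using assms(1,2) unfolding orientation_def unoriented_def by blast
  show "consistent S ori"
    using assms(3) by (auto simp: consistent_def)
qed

section \<open>Inequalities excluded by regularity and non-triviality\<close>

lemma not_le_inv: "x \<in> carrier S \<Longrightarrow> \<not> x \<sqsubseteq> \<iota> x" "x \<in> carrier S \<Longrightarrow> \<not> \<iota> x \<sqsubseteq> x"
  using regular inv_closed inv_inv unfolding regular_def small_def by (blast, metis)

text \<open>By regularity both inequalities would be strict, so \<open>y\<close> would witness that
  \<open>x\<close> is trivial.\<close>

lemma not_le_both:
  assumes "x \<in> carrier S" "y \<in> carrier S" "x \<sqsubseteq> y"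
  shows "\<not> x \<sqsubseteq> \<iota> y"
proof
  assume le: "x \<sqsubseteq> \<iota> y"
  have "x \<noteq> y" "x \<noteq> \<iota> y"
    using le assms not_le_inv by auto
  then show False
    using not_trivial[OF assms(1)] assms le unfolding trivial_def sep_less_def by auto
qed

lemma not_both_le:
  assumes "x \<in> carrier S" "y \<in> carrier S" "x \<sqsubseteq> y"
  shows "\<not> \<iota> x \<sqsubseteq> y"
  using not_le_both[of "\<iota> y" "\<iota> x"] assms inv_closed inv_inv inv_le_iff by metis

lemma nested_cases:
  assumes "x \<in> carrier S" "y \<in> carrier S"
  obtains "x \<sqsubseteq> y" | "y \<sqsubseteq> x" | "x \<sqsubseteq> \<iota> y" | "\<iota> x \<sqsubseteq> y"
  using all_nested[OF assms] inv_le_iff[OF assms] unfolding nested_def unoriented_def by auto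

text \<open>Among the four nested cases, \<open>x \<sqsubseteq> \<iota> y\<close> would put
  \<open>a\<close> below both orientations of \<open>y\<close>, and
  \<open>\<iota> x \<sqsubseteq> y\<close> would put both orientations of \<open>x\<close> below
  \<open>b\<close>; neither is possible.\<close>

lemma interval_chain:
  assumes "a \<in> carrier S" "b \<in> carrier S" "a \<sqsubseteq> b"
  shows "chain_in S {x \<in> carrier S. a \<sqsubseteq> x \<and> x \<sqsubseteq> b}"
  unfolding chain_in_def
proof (intro conjI ballI; clarsimp)
  fix x y
  assume x: "x \<in> carrier S" "a \<sqsubseteq> x" "x \<sqsubseteq> b" and y: "y \<in> carrier S" "a \<sqsubseteq> y" "y \<sqsubseteq> b" "\<not> y \<sqsubseteq> x"
  show "x \<sqsubseteq> y"
  proof (rule nested_cases[OF x(1) y(1)])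
    assume "x \<sqsubseteq> \<iota> y"
    then show ?thesis
      using not_le_both[OF assms(1) y(1,2)] le_trans[of a x "\<iota> y"] x y assms inv_closed by blast
  next
    assume "\<iota> x \<sqsubseteq> y"
    then show ?thesis
      using not_both_le[OF x(1) assms(2) x(3)] le_trans[of "\<iota> x" y b] x y assms inv_closed by blast
  qed (use y in auto)
qed

section \<open>Consistent orientations and two constructions of splitting ones\<close>

text \<open>If \<open>\<iota> x\<close> were chosen instead of \<open>x\<close>, consistency would
  force \<open>x\<close> and \<open>y\<close> to orient the same separation. Then
  \<open>y = x\<close>, which is not chosen, or \<open>y = \<iota> x\<close>, which makes
  \<open>x\<close> small.\<close>

lemma consistent_downward_closed:
  assumes "orientation S ori" "consistent S ori" "y \<in> ori" "x \<in> carrier S" "x \<sqsubseteq> y"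
  shows "x \<in> ori"
proof (rule ccontr)
  assume "x \<notin> ori"
  then have mem: "\<iota> x \<in> ori" "y \<in> carrier S"
    using assms unfolding orientation_def unoriented_def by blast+
  then have "unoriented S (\<iota> x) = unoriented S y"
    using assms(2,3,5) inv_inv[OF assms(4)] unfolding consistent_def by metis
  then have "x = y \<or> \<iota> x = y"
    using unoriented_eq_iff[of "\<iota> x" y] inv_inv mem assms(4) inv_closed by metis
  then show False
    using \<open>x \<notin> ori\<close> assms(3-5) not_le_inv by auto
qed

lemma orientation_exclusive:
  assumes "orientation S ori" "x \<in> carrier S"
  shows "\<iota> x \<in> ori \<longleftrightarrow> x \<notin> ori"
proof -
  have "x \<noteq> \<iota> x"
    using not_le_inv le_refl assms(2) by metis
  then show ?thesis
    using assms unfolding orientation_def unoriented_def by blast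
qed

text \<open>Maximality of \<open>m\<close> turns the nested cases \<open>m \<sqsubseteq> x\<close>
  and \<open>m \<sqsubseteq> \<iota> x\<close> into equalities, so one orientation of
  \<open>x\<close> is always below \<open>m\<close>. Inconsistency would put both orientations of
  some separation below \<open>m\<close>.\<close>

lemma down_set_splitting:
  assumes "m \<in> carrier S" and max: "\<And>x. \<lbrakk>x \<in> carrier S; m \<sqsubseteq> x\<rbrakk> \<Longrightarrow> x = m"
  shows "{x \<in> carrier S. x \<sqsubseteq> m} \<in> splitting_orientations S" (is "?O \<in> _")
proof -
  have total: "x \<in> ?O \<or> \<iota> x \<in> ?O" if x: "x \<in> carrier S" for x
  proof (rule nested_cases[OF x assms(1)])
    assume "m \<sqsubseteq> x"
    then show ?thesis using max[OF x] le_refl x by auto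
  next
    assume "x \<sqsubseteq> \<iota> m"
    then have "m \<sqsubseteq> \<iota> x" using inv_le_iff x assms(1) by blast
    then show ?thesis using max[of "\<iota> x"] inv_closed le_refl x by auto
  qed (use x inv_closed in auto)
  have cons: "\<not> \<iota> x \<sqsubseteq> y" if "x \<in> ?O" "y \<in> ?O" for x y
    using that not_both_le[of x m] le_trans[of "\<iota> x" y m] assms(1) inv_closed by blast
  have "maximal_in S ?O m"
    using assms le_refl by (auto simp: maximal_in_def sep_less_def)
  then have "splitting S ?O"
    by (auto simp: splitting_def)
  then show ?thesis
    using orientationI[of ?O] total cons by (auto simp: splitting_orientations_def)
qed

text \<open>The orientation towards the node between the consecutive edges \<open>c\<close> and \<open>d\<close>: its maximal
  elements are \<open>c\<close>, \<open>\<iota> d\<close> and the maximal elements below both \<open>d\<close> and \<open>\<iota> c\<close>.\<close>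

lemma jump_splitting:
  fixes c d
  defines "B \<equiv> {x \<in> carrier S. x \<sqsubseteq> d \<and> x \<sqsubseteq> \<iota> c}"
  assumes c: "c \<in> carrier S" and d: "d \<in> carrier S" and "c \<sqsubseteq> d" "c \<noteq> d"
    and jump: "\<And>x. \<lbrakk>x \<in> carrier S; c \<sqsubseteq> x; x \<sqsubseteq> d\<rbrakk> \<Longrightarrow> x = c \<or> x = d"
    and max: "\<And>x. x \<in> B \<Longrightarrow> \<exists>m\<in>B. x \<sqsubseteq> m \<and> (\<forall>y\<in>B. m \<sqsubseteq> y \<longrightarrow> y = m)"
  shows "{x \<in> carrier S. x \<sqsubseteq> c \<or> x \<sqsubseteq> \<iota> d} \<union> B \<in> splitting_orientations S"
    (is "?A \<union> B \<in> _")
proof -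
  note le = le_trans inv_closed inv_inv c d
  have ndc: "\<not> d \<sqsubseteq> c"
    using le_antisym assms(4,5) c d by blast
  have cases: "x \<in> carrier S \<and> (x \<sqsubseteq> c \<or> x \<sqsubseteq> \<iota> d \<or> x \<sqsubseteq> d \<and> x \<sqsubseteq> \<iota> c)" if "x \<in> ?A \<union> B" for x
    using that by (auto simp: B_def)
  have total: "x \<in> ?A \<union> B \<or> \<iota> x \<in> ?A \<union> B" if x: "x \<in> carrier S" for x
  proof -
    have ix: "\<iota> x \<in> carrier S" using x inv_closed by blast
    \<comment> \<open>If no orientation of \<open>x\<close> lies below \<open>c\<close> or
      \<open>\<iota> d\<close>, then one lies above \<open>c\<close> and one below \<open>d\<close>.
      If they coincide, the jump applies; if they are opposite, the one below \<open>d\<close> is in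
      \<open>B\<close>.\<close>
    have 1: "x \<sqsubseteq> c \<or> \<iota> x \<sqsubseteq> c \<or> c \<sqsubseteq> x \<or> c \<sqsubseteq> \<iota> x"
      by (rule nested_cases[OF x c]) (use inv_le_iff[OF x c] in auto)
    have 2: "x \<sqsubseteq> \<iota> d \<or> \<iota> x \<sqsubseteq> \<iota> d \<or> x \<sqsubseteq> d \<or> \<iota> x \<sqsubseteq> d"
      by (rule nested_cases[OF x d]) (use inv_le_iff[OF x d] in auto)
    have jx: "x \<sqsubseteq> c \<or> \<iota> x \<sqsubseteq> \<iota> d" if "c \<sqsubseteq> x" "x \<sqsubseteq> d"
      using jump[OF x that] le_refl inv_closed x by auto
    have jix: "\<iota> x \<sqsubseteq> c \<or> x \<sqsubseteq> \<iota> d" if "c \<sqsubseteq> \<iota> x" "\<iota> x \<sqsubseteq> d"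
      using jump[OF ix that] le_refl inv_closed inv_inv[OF x] ix x by metis
    show ?thesis
      using 1 2 jx jix inv_le_iff[OF x c] x ix inv_inv by (auto simp: B_def)
  qed
  \<comment> \<open>Below the same edge, \<open>not_both_le\<close> applies; below different edges,
    the inequality would give \<open>d \<sqsubseteq> c\<close>.\<close>
  have cons_A: "\<not> \<iota> x \<sqsubseteq> y" if "x \<in> ?A" "y \<in> ?A" for x y
    using that not_both_le[of x c] not_both_le[of x "\<iota> d"] inv_le_iff[of x c] inv_le_iff[of x d]
      inv_le_iff[of x y] ndc by auto (metis le)+
  \<comment> \<open>The inequality would give \<open>\<iota> c \<sqsubseteq> d\<close> or
    \<open>d \<sqsubseteq> \<iota> c\<close>, both incompatible with
    \<open>c \<sqsubseteq> d\<close>.\<close>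
  have cons_AB: "\<not> \<iota> x \<sqsubseteq> y" if "x \<in> ?A" "y \<in> B" for x y
    using that not_both_le[OF c d] not_le_inv[OF c] \<open>c \<sqsubseteq> d\<close> inv_le_iff[of x c] inv_le_iff[of x d]
    by (auto simp: B_def) (metis le inv_le_iff)+
  have cons_B: "\<not> \<iota> x \<sqsubseteq> y" if "x \<in> B" "y \<in> B" for x y
    using that not_both_le[of x d] by (auto simp: B_def) (metis le)
  have cons: "\<not> \<iota> x \<sqsubseteq> y" if "x \<in> ?A \<union> B" "y \<in> ?A \<union> B" for x y
    using that cons_A cons_AB cons_B inv_le_iff[of x y] unfolding B_def by blast
  have max_c: "maximal_in S (?A \<union> B) c"
  proof -
    have "y = c" if "y \<in> ?A \<union> B" "c \<sqsubseteq> y" for y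
      using cases[OF that(1)] that(2) not_le_both[OF c d] not_le_inv(1)[OF c] \<open>c \<sqsubseteq> d\<close>
      by (metis le le_antisym)
    then show ?thesis
      using c le_refl by (auto simp: maximal_in_def sep_less_def)
  qed
  have max_d: "maximal_in S (?A \<union> B) (\<iota> d)"
  proof -
    have "y = \<iota> d" if "y \<in> ?A \<union> B" "\<iota> d \<sqsubseteq> y" for y
      using cases[OF that(1)] that(2) not_both_le[OF d d] not_both_le[OF c d] inv_le_iff(1)[OF c d]
        le_refl[OF d] \<open>c \<sqsubseteq> d\<close>
      by (metis le le_antisym)
    then show ?thesis
      using d inv_closed le_refl by (auto simp: maximal_in_def sep_less_def)
  qed
  have max_B: "maximal_in S (?A \<union> B) m" if m: "m \<in> B" "\<forall>y\<in>B. m \<sqsubseteq> y \<longrightarrow> y = m" for m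
  proof -
    have mS: "m \<in> carrier S" "m \<sqsubseteq> d" "m \<sqsubseteq> \<iota> c"
      using m(1) by (auto simp: B_def)
    \<comment> \<open>An element of \<open>?A\<close> above \<open>m\<close> would put
      \<open>m\<close> below both orientations of \<open>c\<close> or of \<open>d\<close>, so only
      elements of \<open>B\<close> compete with \<open>m\<close>.\<close>
    have "y = m" if "y \<in> ?A \<union> B" "m \<sqsubseteq> y" for y
    proof (cases "y \<in> B")
      case False
      then have "y \<in> carrier S" "y \<sqsubseteq> c \<or> y \<sqsubseteq> \<iota> d"
        using that(1) by auto
      then show ?thesis
        using that(2) mS not_le_both[of m c] not_le_both[of m d] by (metis le)
    qed (use m that in blast)
    then show ?thesis
      using m by (auto simp: maximal_in_def sep_less_def)
  qed
  have "splitting S (?A \<union> B)"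
    using max_c max_d max_B max unfolding splitting_def by blast
  then show ?thesis
    using orientationI[of "?A \<union> B"] total cons by (auto simp: splitting_orientations_def B_def)
qed

end

section \<open>Suprema of chains\<close>

text \<open>\<open>h\<close> abstracts the embedding of a profinite tree set into a product of finite systems.\<close>

locale coordinatized_tree_set = regular_tree_set +
  fixes h :: "'a \<Rightarrow> 'p \<Rightarrow> 'b"
  assumes coord_inj: "inj_on h (carrier S)"
    and coord_convex: "\<lbrakk>x \<in> carrier S; y \<in> carrier S; z \<in> carrier S; x \<sqsubseteq> y; y \<sqsubseteq> z; h x p = h z p\<rbrakk>
      \<Longrightarrow> h y p = h x p"
    and coord_inv: "\<lbrakk>x \<in> carrier S; y \<in> carrier S; h x p = h y p\<rbrakk> \<Longrightarrow> h (\<iota> x) p = h (\<iota> y) p"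
    and chain_sup: "\<lbrakk>chain_in S C; C \<noteq> {}\<rbrakk> \<Longrightarrow>
      \<exists>u. supremum_in S C u \<and> (\<forall>p. \<exists>x\<in>C. h u p = h x p)"
begin

section \<open>Maximal elements and jumps\<close>

lemma exists_maximal_above:
  assumes "B \<subseteq> carrier S" "x \<in> B"
    and closed: "\<And>C u. \<lbrakk>C \<subseteq> B; C \<noteq> {}; supremum_in S C u\<rbrakk> \<Longrightarrow> u \<in> B"
  shows "\<exists>m\<in>B. x \<sqsubseteq> m \<and> (\<forall>y\<in>B. m \<sqsubseteq> y \<longrightarrow> y = m)"
proof -
  \<comment> \<open>Zorn's lemma is applied to the part of \<open>B\<close> above \<open>x\<close>,
    so that \<open>x\<close> bounds the empty chain and the maximal element lies above
    \<open>x\<close>.\<close>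
  define A where "A = {y \<in> B. x \<sqsubseteq> y}"
  have x: "x \<in> A" "x \<in> carrier S"
    using assms le_refl by (auto simp: A_def)
  have A: "A \<subseteq> carrier S" "A \<subseteq> B"
    using assms by (auto simp: A_def)
  have "\<exists>m\<in>A. \<forall>y\<in>A. m \<sqsubseteq> y \<longrightarrow> y = m"
  proof (rule predicate_Zorn)
    show "partial_order_on A (relation_of (\<sqsubseteq>) A)"
    proof (rule partial_order_on_relation_ofI)
      show "a \<sqsubseteq> a" if "a \<in> A" for a
        using that A(1) le_refl by blast
      show "a \<sqsubseteq> c" if "a \<in> A" "b \<in> A" "c \<in> A" "a \<sqsubseteq> b" "b \<sqsubseteq> c" for a b c
        using that A(1) le_trans[of a b c] by blast
      show "a = b" if "a \<in> A" "b \<in> A" "a \<sqsubseteq> b" "b \<sqsubseteq> a" for a b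
        using that A(1) le_antisym[of a b] by blast
    qed
    fix C assume C: "C \<in> Chains (relation_of (\<sqsubseteq>) A)"
    then have CA: "C \<subseteq> A" and ch: "chain_in S C"
      using A(1) by (auto simp: Chains_def relation_of_def chain_in_def)
    show "\<exists>u\<in>A. \<forall>a\<in>C. a \<sqsubseteq> u"
    proof (cases "C = {}")
      case False
      then obtain u y where u: "supremum_in S C u" and y: "y \<in> C"
        using chain_sup[OF ch] by blast
      then have "u \<in> B" "y \<sqsubseteq> u" "x \<sqsubseteq> y"
        using closed[OF _ False u] CA A by (auto simp: supremum_in_def A_def)
      then have "u \<in> A"
        using le_trans[of x y u] x y u CA A by (auto simp: A_def supremum_in_def)
      then show ?thesis
        using u by (auto simp: supremum_in_def)
    qed (use x in auto)
  qed
  then show ?thesis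
    using assms(1) x le_trans unfolding A_def by blast
qed

text \<open>By convexity the elements of the interval that agree with \<open>a\<close> at
  \<open>p\<close> form an initial segment. Since suprema attain their coordinates, \<open>c\<close>
  still belongs to it and \<open>d\<close> to its complement, which leaves no room between
  them.\<close>

lemma exists_jump:
  assumes a: "a \<in> carrier S" and b: "b \<in> carrier S" and "a \<sqsubseteq> b" "a \<noteq> b"
  obtains c d where "c \<in> carrier S" "d \<in> carrier S" "a \<sqsubseteq> c" "c \<sqsubseteq> d" "d \<sqsubseteq> b" "c \<noteq> d"
    "\<forall>x\<in>carrier S. c \<sqsubseteq> x \<and> x \<sqsubseteq> d \<longrightarrow> x = c \<or> x = d"
proof -
  define I where "I = {x \<in> carrier S. a \<sqsubseteq> x \<and> x \<sqsubseteq> b}"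
  have I: "I \<subseteq> carrier S" "a \<in> I" "b \<in> I"
    using a b assms(3) le_refl by (auto simp: I_def)
  have comparable: "x \<sqsubseteq> y \<or> y \<sqsubseteq> x" if "x \<in> I" "y \<in> I" for x y
    using interval_chain[OF a b assms(3)] that unfolding I_def chain_in_def by blast
  obtain p where p: "h a p \<noteq> h b p"
    using coord_inj assms by (meson ext inj_onD)
  define C where "C = {x \<in> I. h x p = h a p}"
  define D where "D = {x \<in> I. h x p \<noteq> h a p}"
  have "chain_in S C" "a \<in> C"
    using comparable I by (auto simp: chain_in_def C_def)
  then obtain c y where "supremum_in S C c" "y \<in> C" "h c p = h y p"
    using chain_sup[of C] by blast
  then have c: "supremum_in S C c" "h c p = h a p"
    by (auto simp: C_def)
  have cI: "c \<in> I"
    using c b \<open>a \<in> C\<close> unfolding supremum_in_def C_def I_def by blast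
  \<comment> \<open>The infimum of \<open>D\<close> is obtained by applying the involution to the
    supremum \<open>e\<close> of the reversed chain.\<close>
  have "chain_in S (sep_inv S ` D)" "b \<in> D"
    using comparable I inv_le_iff(3) inv_closed p by (auto simp: chain_in_def D_def subset_iff)
  then obtain e x where e: "supremum_in S (sep_inv S ` D) e" and x: "x \<in> D" "h e p = h (\<iota> x) p"
    using chain_sup[of "sep_inv S ` D"] by blast
  have eS: "e \<in> carrier S"
    using e by (auto simp: supremum_in_def)
  define d where "d = \<iota> e"
  have d: "d \<in> carrier S" "\<iota> d = e"
    using eS inv_closed inv_inv by (auto simp: d_def)
  have d_le: "d \<sqsubseteq> y" if "y \<in> D" for y
    using e that d inv_le_iff(3)[of y d] I unfolding supremum_in_def D_def by auto
  have "e \<sqsubseteq> \<iota> a"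
    using e a inv_closed inv_le_iff(3) I unfolding supremum_in_def D_def I_def by blast
  then have dI: "d \<in> I"
    using d_le[OF \<open>b \<in> D\<close>] d inv_le_iff(3)[of d a] a by (auto simp: I_def)
  have xS: "x \<in> carrier S"
    using x I by (auto simp: D_def)
  have "h d p = h x p"
    using coord_inv[OF eS inv_closed[OF xS] x(2)] inv_inv[OF xS] by (simp add: d_def)
  then have dD: "d \<in> D"
    using x dI by (auto simp: D_def)
  have cS: "c \<in> carrier S" "a \<sqsubseteq> c"
    using cI by (auto simp: I_def)
  \<comment> \<open>If \<open>d \<sqsubseteq> c\<close>, convexity between \<open>a\<close> and
    \<open>c\<close> would make \<open>d\<close> agree with \<open>a\<close> at
    \<open>p\<close>.\<close>
  have ncd: "\<not> d \<sqsubseteq> c"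
    using coord_convex[of a d c p] dD cS a c d by (auto simp: D_def I_def)
  show thesis
  proof
    show "c \<sqsubseteq> d"
      using comparable[OF cI dI] ncd by blast
    show "c \<noteq> d"
      using ncd le_refl cS by auto
    have "y = c \<or> y = d" if y: "y \<in> carrier S" "c \<sqsubseteq> y" "y \<sqsubseteq> d" for y
    proof -
      have "y \<in> I"
        using le_trans[of a c y] le_trans[of y d b] y dI cS a b d by (auto simp: I_def)
      then have "y \<in> C \<or> y \<in> D"
        by (auto simp: C_def D_def)
      then have "y \<sqsubseteq> c \<or> d \<sqsubseteq> y"
        using d_le c by (auto simp: supremum_in_def)
      then show ?thesis
        using le_antisym y cS d by blast
    qed
    then show "\<forall>x\<in>carrier S. c \<sqsubseteq> x \<and> x \<sqsubseteq> d \<longrightarrow> x = c \<or> x = d"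
      by blast
  qed (use cS d dI in \<open>auto simp: I_def\<close>)
qed

section \<open>Splitting orientations containing given elements\<close>

lemma exists_splitting_orientation_single:
  assumes "a \<in> carrier S"
  shows "\<exists>ori\<in>splitting_orientations S. a \<in> ori"
proof -
  obtain m where m: "m \<in> carrier S" "a \<sqsubseteq> m" "\<forall>y\<in>carrier S. m \<sqsubseteq> y \<longrightarrow> y = m"
    using exists_maximal_above[of "carrier S" a] assms unfolding supremum_in_def by blast
  show ?thesis
  proof
    show "{x \<in> carrier S. x \<sqsubseteq> m} \<in> splitting_orientations S"
      using down_set_splitting m by simp
  qed (use assms m in simp)
qed

text \<open>The condition is also necessary, as a consistent orientation containing \<open>b\<close>
  contains everything below \<open>b\<close>. For comparable \<open>a\<close> and \<open>b\<close>
  an orientation containing the larger one suffices; otherwise a jump between \<open>a\<close> and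
  \<open>\<iota> b\<close> is used.\<close>

lemma exists_splitting_orientation:
  assumes a: "a \<in> carrier S" and b: "b \<in> carrier S" and nle: "\<not> \<iota> a \<sqsubseteq> b"
  shows "\<exists>ori\<in>splitting_orientations S. a \<in> ori \<and> b \<in> ori"
proof (rule nested_cases[OF a b])
  assume le: "a \<sqsubseteq> \<iota> b"
  have ib: "\<iota> b \<in> carrier S" "\<iota> (\<iota> b) = b"
    using b inv_closed inv_inv by auto
  have neq: "a \<noteq> \<iota> b"
    using nle le_refl b ib by auto
  obtain c d where c: "c \<in> carrier S" and d: "d \<in> carrier S" and "a \<sqsubseteq> c"
    and cd: "c \<sqsubseteq> d" and "d \<sqsubseteq> \<iota> b" and neq: "c \<noteq> d"
    and jump: "\<forall>x\<in>carrier S. c \<sqsubseteq> x \<and> x \<sqsubseteq> d \<longrightarrow> x = c \<or> x = d"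
    by (rule exists_jump[OF a ib(1) le neq])
  define B where "B = {x \<in> carrier S. x \<sqsubseteq> d \<and> x \<sqsubseteq> \<iota> c}"
  have max: "\<exists>m\<in>B. x \<sqsubseteq> m \<and> (\<forall>y\<in>B. m \<sqsubseteq> y \<longrightarrow> y = m)" if "x \<in> B" for x
  proof (rule exists_maximal_above[OF _ that])
    \<comment> \<open>Both \<open>d\<close> and \<open>\<iota> c\<close> are upper bounds of every
      subset of \<open>B\<close>, so suprema stay in \<open>B\<close>.\<close>
    show "u \<in> B" if "C \<subseteq> B" "supremum_in S C u" for C u
      using that d inv_closed[OF c] by (auto simp: supremum_in_def B_def subset_iff)
  qed (auto simp: B_def)
  have "b \<sqsubseteq> \<iota> d"
    using \<open>d \<sqsubseteq> \<iota> b\<close> inv_le_iff(2)[OF d b] by simp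
  moreover have "{x \<in> carrier S. x \<sqsubseteq> c \<or> x \<sqsubseteq> \<iota> d} \<union> B \<in> splitting_orientations S"
    using jump_splitting[OF c d cd neq] jump max by (simp add: B_def)
  ultimately show ?thesis
    using a b \<open>a \<sqsubseteq> c\<close>
    by (intro bexI[of _ "{x \<in> carrier S. x \<sqsubseteq> c \<or> x \<sqsubseteq> \<iota> d} \<union> B"]) simp_all
next
  assume "a \<sqsubseteq> b"
  obtain ori where ori: "ori \<in> splitting_orientations S" "b \<in> ori"
    using exists_splitting_orientation_single[OF b] ..
  then have "a \<in> ori"
    using consistent_downward_closed[OF _ _ _ a \<open>a \<sqsubseteq> b\<close>]
    by (simp add: splitting_orientations_def)
  then show ?thesis
    using ori by (intro bexI[of _ ori]) simp_all
next
  assume "b \<sqsubseteq> a"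
  obtain ori where ori: "ori \<in> splitting_orientations S" "a \<in> ori"
    using exists_splitting_orientation_single[OF a] ..
  then have "b \<in> ori"
    using consistent_downward_closed[OF _ _ _ b \<open>b \<sqsubseteq> a\<close>]
    by (simp add: splitting_orientations_def)
  then show ?thesis
    using ori by (intro bexI[of _ ori]) simp_all
qed (use nle in simp)

section \<open>The bipartition map as an order embedding\<close>

text \<open>The inclusion compares the first sides of the two bipartitions. If
  \<open>r \<sqsubseteq> s\<close> fails, an orientation containing \<open>\<iota> r\<close> and
  \<open>s\<close> violates it; the converse is downward closure.\<close>

lemma bipartition_map_le_iff:
  assumes r: "r \<in> carrier S" and s: "s \<in> carrier S"
  shows "splitting_orientations_at S (\<iota> r) \<subseteq> splitting_orientations_at S (\<iota> s) \<longleftrightarrow> r \<sqsubseteq> s"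
proof
  assume sub: "splitting_orientations_at S (\<iota> r) \<subseteq> splitting_orientations_at S (\<iota> s)"
  show "r \<sqsubseteq> s"
  proof (rule ccontr)
    assume "\<not> r \<sqsubseteq> s"
    then obtain ori where ori: "ori \<in> splitting_orientations S" "\<iota> r \<in> ori" "s \<in> ori"
      using exists_splitting_orientation[of "\<iota> r" s] r s inv_closed inv_inv by auto
    then have "\<iota> s \<in> ori"
      using sub by (auto simp: splitting_orientations_at_def)
    then show False
      using orientation_exclusive s ori by (auto simp: splitting_orientations_def)
  qed
next
  assume "r \<sqsubseteq> s"
  then have "\<iota> s \<sqsubseteq> \<iota> r"
    using inv_antimono r s by blast
  then show "splitting_orientations_at S (\<iota> r) \<subseteq> splitting_orientations_at S (\<iota> s)"
    using consistent_downward_closed[of _ "\<iota> r" "\<iota> s"] inv_closed s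
    by (auto simp: splitting_orientations_at_def splitting_orientations_def)
qed

lemma bipartition_map_carrier:
  assumes s: "s \<in> carrier S"
  shows "bipartition_map S s \<in> carrier (bipartitions (splitting_orientations S))"
proof -
  let ?O = splitting_orientations_at
  have "?O S s \<noteq> {}" "?O S (\<iota> s) \<noteq> {}"
    using exists_splitting_orientation_single s inv_closed
    unfolding splitting_orientations_at_def by blast+
  moreover have "?O S (\<iota> s) = splitting_orientations S - ?O S s"
    using orientation_exclusive[OF _ s]
    by (auto simp: splitting_orientations_at_def splitting_orientations_def)
  moreover have "?O S s \<subseteq> splitting_orientations S"
    by (auto simp: splitting_orientations_at_def)
  ultimately show ?thesis
    unfolding bipartition_map_def bipartitions_def by auto
qed

end

section \<open>Images of order embeddings\<close>

text \<open>A map reflecting the order is injective by antisymmetry, so strict inequalities, and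
  with them triviality, pull back to \<open>S\<close>. Nestedness comes from \<open>S\<close> as
  well, so \<open>T\<close> may contain crossing separations, as a system of bipartitions
  may.\<close>

lemma tree_set_iso_image:
  assumes "tree_set S" "separation_system T" and f: "f \<in> carrier S \<rightarrow> carrier T"
    and f_inv: "\<And>s. s \<in> carrier S \<Longrightarrow> f (sep_inv S s) = sep_inv T (f s)"
    and f_le: "\<And>r s. \<lbrakk>r \<in> carrier S; s \<in> carrier S\<rbrakk> \<Longrightarrow> f r \<sqsubseteq>\<^bsub>T\<^esub> f s \<longleftrightarrow> r \<sqsubseteq>\<^bsub>S\<^esub> s"
  shows "tree_set_iso S (induced T (f ` carrier S)) f"
proof -
  interpret S: tree_set S by fact
  interpret T: separation_system T by fact
  let ?I = "induced T (f ` carrier S)"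
  have I [simp]: "carrier ?I = f ` carrier S" "sep_le ?I = sep_le T" "sep_inv ?I = sep_inv T"
    by (auto simp: induced_def)
  have inj: "inj_on f (carrier S)"
    using f f_le S.le_antisym T.le_refl by (intro inj_onI) (metis funcset_mem)
  have f_less: "sep_less ?I (f r) (f s) \<longleftrightarrow> sep_less S r s" if "r \<in> carrier S" "s \<in> carrier S" for r s
    using that f_le inj by (auto simp: sep_less_def inj_on_eq_iff)
  have "tree_set ?I"
  proof
    show "poset_on (carrier ?I) (sep_le ?I)"
      using T.poset f
      unfolding poset_on_def reflp_on_def antisymp_on_def transp_on_def I by blast
    show "sep_inv ?I x \<in> carrier ?I" if "x \<in> carrier ?I" for x
      using that f_inv S.inv_closed by (auto simp flip: f_inv)
    show "sep_inv ?I (sep_inv ?I x) = x" if "x \<in> carrier ?I" for x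
      using that f T.inv_inv by auto
    show "sep_le ?I (sep_inv ?I y) (sep_inv ?I x)"
      if "x \<in> carrier ?I" "y \<in> carrier ?I" "sep_le ?I x y" for x y
      using that f T.inv_antimono by auto
    show "nested ?I x y" if "x \<in> carrier ?I" "y \<in> carrier ?I" for x y
    proof -
      obtain r s where rs: "r \<in> carrier S" "s \<in> carrier S" "x = f r" "y = f s"
        using \<open>x \<in> carrier ?I\<close> \<open>y \<in> carrier ?I\<close> by auto
      have unoriented_image: "unoriented ?I (f s) = f ` unoriented S s" if "s \<in> carrier S" for s
        using that f_inv by (auto simp: unoriented_def)
      have "unoriented S r \<subseteq> carrier S" "unoriented S s \<subseteq> carrier S"
        using rs S.inv_closed by (auto simp: unoriented_def)
      then show ?thesis
        using S.all_nested[OF rs(1,2)] rs f_le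
        by (fastforce simp: nested_def unoriented_image)
    qed
    show "\<not> degenerate ?I x" if "x \<in> carrier ?I" for x
      using that S.not_degenerate S.inv_closed
      by (auto simp: degenerate_def inj_on_eq_iff[OF inj] simp flip: f_inv)
    show "\<not> trivial ?I x" if "x \<in> carrier ?I" for x
      using that S.not_trivial S.inv_closed
      by (auto simp: trivial_def f_less simp flip: f_inv)
  qed
  moreover have "sep_iso S ?I f"
    using inj S.inv_closed f_le f_inv
    by (auto simp: sep_iso_def sep_hom_def inj_on_imp_bij_betw simp flip: f_inv)
  ultimately show ?thesis
    using assms(1) by (simp add: tree_set_iso_def)
qed

section \<open>Suprema in inverse limits\<close>

lemma finite_chain_has_greatest:
  assumes "finite A" "A \<noteq> {}" "poset_on K R" "A \<subseteq> K" "\<forall>x\<in>A. \<forall>y\<in>A. R x y \<or> R y x"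
  shows "\<exists>m\<in>A. \<forall>x\<in>A. R x m"
  using assms
proof (induction A rule: finite_ne_induct)
  case (insert x F)
  then obtain m where m: "m \<in> F" "\<forall>y\<in>F. R y m"
    by auto
  have "R x x"
    using insert.prems by (auto simp: poset_on_def reflp_on_def)
  consider "R x m" | "R m x"
    using insert.prems m by auto
  then show ?case
  proof cases
    case 2
    then have "\<forall>y\<in>F. R y x"
      using m insert.prems unfolding poset_on_def transp_on_def by blast
    then show ?thesis
      using \<open>R x x\<close> by blast
  qed (use m in blast)
qed (auto simp: poset_on_def reflp_on_def)

text \<open>Finiteness gives a greatest value in each coordinate. Monotone bonding maps send
  greatest values to greatest values, so these form a point of the limit.\<close>

lemma inverse_limit_chain_sup:
  assumes sys: "finite_inverse_system P R F f" and "C \<subseteq> carrier (inverse_limit P R F f)" "C \<noteq> {}"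
    and ch: "\<forall>x\<in>C. \<forall>y\<in>C. x \<sqsubseteq>\<^bsub>inverse_limit P R F f\<^esub> y \<or> y \<sqsubseteq>\<^bsub>inverse_limit P R F f\<^esub> x"
  shows "\<exists>u\<in>carrier (inverse_limit P R F f).
    (\<forall>p\<in>P. (\<exists>x\<in>C. u p = x p) \<and> (\<forall>x\<in>C. x p \<sqsubseteq>\<^bsub>F p\<^esub> u p))"
proof -
  have C: "x p \<in> carrier (F p)" if "x \<in> C" "p \<in> P" for x p
    using that assms(2) by (auto simp: inverse_limit_def)
  have fin: "separation_system (F p)" "finite (carrier (F p))" if "p \<in> P" for p
    using sys that by (auto simp: finite_inverse_system_def)
  have greatest: "\<exists>m\<in>(\<lambda>x. x p) ` C. \<forall>y\<in>(\<lambda>x. x p) ` C. y \<sqsubseteq>\<^bsub>F p\<^esub> m" if p: "p \<in> P" for p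
  proof (rule finite_chain_has_greatest)
    show "poset_on (carrier (F p)) (sep_le (F p))"
      using fin[OF p] separation_system.poset by blast
    show "finite ((\<lambda>x. x p) ` C)"
      using C p by (intro finite_subset[OF _ fin(2)[OF p]]) auto
    show "\<forall>x\<in>(\<lambda>x. x p) ` C. \<forall>y\<in>(\<lambda>x. x p) ` C. x \<sqsubseteq>\<^bsub>F p\<^esub> y \<or> y \<sqsubseteq>\<^bsub>F p\<^esub> x"
      using ch p by (auto simp: inverse_limit_def)
  qed (use C p \<open>C \<noteq> {}\<close> in auto)
  have "\<forall>p\<in>P. \<exists>m. m \<in> (\<lambda>x. x p) ` C \<and> (\<forall>x\<in>C. x p \<sqsubseteq>\<^bsub>F p\<^esub> m)"
  proof
    fix p assume "p \<in> P"
    from greatest[OF this] obtain m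
      where "m \<in> (\<lambda>x. x p) ` C" "\<forall>y\<in>(\<lambda>x. x p) ` C. y \<sqsubseteq>\<^bsub>F p\<^esub> m" ..
    then show "\<exists>m. m \<in> (\<lambda>x. x p) ` C \<and> (\<forall>x\<in>C. x p \<sqsubseteq>\<^bsub>F p\<^esub> m)"
      by (intro exI[of _ m]) simp
  qed
  from bchoice[OF this] obtain m
    where "\<forall>p\<in>P. m p \<in> (\<lambda>x. x p) ` C \<and> (\<forall>x\<in>C. x p \<sqsubseteq>\<^bsub>F p\<^esub> m p)" ..
  then have m: "\<And>p. p \<in> P \<Longrightarrow> m p \<in> (\<lambda>x. x p) ` C"
      "\<And>p x. \<lbrakk>p \<in> P; x \<in> C\<rbrakk> \<Longrightarrow> x p \<sqsubseteq>\<^bsub>F p\<^esub> m p"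
    by simp_all
  have mF: "m p \<in> carrier (F p)" if "p \<in> P" for p
    using m(1)[OF that] C[OF _ that] by auto
  \<comment> \<open>With \<open>x\<close> attaining the maximum at \<open>p\<close> and
    \<open>y\<close> at \<open>q\<close>, one has \<open>m p = f q p (x q) \<sqsubseteq> f q p (m q)
    = y p \<sqsubseteq> m p\<close>.\<close>
  have compatible: "f q p (m q) = m p" if p: "p \<in> P" and q: "q \<in> P" and pq: "R p q" for p q
  proof -
    obtain x y where xy: "x \<in> C" "m p = x p" "y \<in> C" "m q = y q"
      using m(1) p q by blast
    have bond: "f q p (z q) = z p" if "z \<in> C" for z
      using that assms(2) p q pq by (auto simp: inverse_limit_def)
    have "sep_hom (F q) (F p) (f q p)"
      using sys p q pq by (auto simp: finite_inverse_system_def)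
    then have "f q p (x q) \<sqsubseteq>\<^bsub>F p\<^esub> f q p (m q)"
      using m(2)[OF q xy(1)] C[OF xy(1) q] mF[OF q] by (auto simp: sep_hom_def)
    then have "m p \<sqsubseteq>\<^bsub>F p\<^esub> y p" "y p \<sqsubseteq>\<^bsub>F p\<^esub> m p"
      using xy bond m(2)[OF p xy(3)] by auto
    then show ?thesis
      using separation_system.le_antisym[OF fin(1)[OF p]] xy bond C p by metis
  qed
  show ?thesis
  proof (rule bexI[of _ "restrict m P"], intro ballI conjI)
    show "restrict m P \<in> carrier (inverse_limit P R F f)"
      using mF compatible by (auto simp: inverse_limit_def)
    fix p assume p: "p \<in> P"
    show "\<exists>x\<in>C. restrict m P p = x p"
      using m(1)[OF p] p by auto
    show "x p \<sqsubseteq>\<^bsub>F p\<^esub> restrict m P p" if "x \<in> C" for x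
      using m(2)[OF p that] p by simp
  qed
qed

section \<open>Coordinates of a profinite tree set\<close>

text \<open>Convexity of a coordinate is antisymmetry in the finite system there; the involution
  acts coordinatewise, and suprema are pulled back along the isomorphism \<open>h\<close>.\<close>

lemma profinite_coordinatized:
  fixes S :: "'a sep_system"
  assumes "tree_set S" "regular S" "profinite TYPE('p) TYPE('b) S"
  shows "\<exists>h :: 'a \<Rightarrow> 'p \<Rightarrow> 'b. coordinatized_tree_set S h"
proof -
  interpret regular_tree_set S
    using assms by (simp add: regular_tree_set_def regular_tree_set_axioms_def)
  obtain P :: "'p set" and R and F :: "'p \<Rightarrow> 'b sep_system" and f h where
    sys: "finite_inverse_system P R F f" and iso: "sep_iso S (inverse_limit P R F f) h"
    using assms(3) unfolding profinite_def by blast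
  let ?L = "inverse_limit P R F f"
  have bij: "bij_betw h (carrier S) (carrier ?L)"
    and hom: "sep_hom S ?L h" "sep_hom ?L S (inv_into (carrier S) h)"
    using iso by (auto simp: sep_iso_def)
  have hL: "h x \<in> carrier ?L" if "x \<in> carrier S" for x
    using that bij by (auto simp: bij_betw_def)
  have h_le: "x \<sqsubseteq>\<^bsub>S\<^esub> y \<longleftrightarrow> (\<forall>p\<in>P. h x p \<sqsubseteq>\<^bsub>F p\<^esub> h y p)" if "x \<in> carrier S" "y \<in> carrier S" for x y
  proof -
    have "x \<sqsubseteq>\<^bsub>S\<^esub> y \<longleftrightarrow> h x \<sqsubseteq>\<^bsub>?L\<^esub> h y"
    proof
      assume "x \<sqsubseteq>\<^bsub>S\<^esub> y"
      then show "h x \<sqsubseteq>\<^bsub>?L\<^esub> h y"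
        using hom(1) that by (simp add: sep_hom_def)
    next
      assume "h x \<sqsubseteq>\<^bsub>?L\<^esub> h y"
      then have "inv_into (carrier S) h (h x) \<sqsubseteq>\<^bsub>S\<^esub> inv_into (carrier S) h (h y)"
        using hom(2) hL that by (simp add: sep_hom_def)
      then show "x \<sqsubseteq>\<^bsub>S\<^esub> y"
        using bij_betw_inv_into_left[OF bij] that by simp
    qed
    then show ?thesis by (simp add: inverse_limit_def)
  qed
  have hF: "h x p \<in> carrier (F p)" if "x \<in> carrier S" "p \<in> P" for x p
    using hL[OF that(1)] that(2) by (auto simp: inverse_limit_def)
  \<comment> \<open>Coordinates range over the whole index type; outside \<open>P\<close> all points
    of the limit take the same default value.\<close>
  have h_undefined: "h x p = undefined" if "x \<in> carrier S" "p \<notin> P" for x p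
    using hL[OF that(1)] that(2) by (auto simp: inverse_limit_def PiE_def extensional_def)
  have F: "separation_system (F p)" if "p \<in> P" for p
    using sys that by (auto simp: finite_inverse_system_def)
  have "coordinatized_tree_set S h"
  proof
    show "inj_on h (carrier S)"
      using bij by (simp add: bij_betw_def)
    show "h y p = h x p"
      if "x \<in> carrier S" "y \<in> carrier S" "z \<in> carrier S" "x \<sqsubseteq>\<^bsub>S\<^esub> y" "y \<sqsubseteq>\<^bsub>S\<^esub> z" "h x p = h z p" for x y z p
    proof (cases "p \<in> P")
      case True
      then have "h x p \<sqsubseteq>\<^bsub>F p\<^esub> h y p" "h y p \<sqsubseteq>\<^bsub>F p\<^esub> h x p"
        using that h_le by auto
      then show ?thesis
        using separation_system.le_antisym[OF F[OF True]] hF that True by blast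
    qed (use h_undefined that in simp)
    show "h (sep_inv S x) p = h (sep_inv S y) p"
      if "x \<in> carrier S" "y \<in> carrier S" "h x p = h y p" for x y p
      using that hom(1) by (auto simp: sep_hom_def inverse_limit_def restrict_def)
    show "\<exists>u. supremum_in S C u \<and> (\<forall>p. \<exists>x\<in>C. h u p = h x p)" if C: "chain_in S C" "C \<noteq> {}" for C
    proof -
      have CS: "C \<subseteq> carrier S"
        using C by (simp add: chain_in_def)
      have "h ` C \<subseteq> carrier ?L" "h ` C \<noteq> {}"
        using CS hL C by auto
      moreover have "\<forall>x\<in>h ` C. \<forall>y\<in>h ` C. x \<sqsubseteq>\<^bsub>?L\<^esub> y \<or> y \<sqsubseteq>\<^bsub>?L\<^esub> x"
        using C hom(1) unfolding chain_in_def sep_hom_def by blast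
      ultimately obtain v where "v \<in> carrier ?L" and
        v: "\<forall>p\<in>P. (\<exists>x\<in>h ` C. v p = x p) \<and> (\<forall>x\<in>h ` C. x p \<sqsubseteq>\<^bsub>F p\<^esub> v p)"
        using inverse_limit_chain_sup[OF sys] by blast
      then obtain u where u: "u \<in> carrier S" "v = h u"
        using bij by (metis bij_betw_imp_surj_on imageE)
      have attained: "\<exists>x\<in>C. h u p = h x p" for p
        using u v h_undefined CS C(2) by (cases "p \<in> P") fastforce+
      \<comment> \<open>In each coordinate \<open>u\<close> agrees with some element of
        \<open>C\<close>, which lies below \<open>w\<close>; attained values thus make
        \<open>u\<close> least.\<close>
      have least: "u \<sqsubseteq>\<^bsub>S\<^esub> w" if w: "w \<in> carrier S" "\<forall>x\<in>C. x \<sqsubseteq>\<^bsub>S\<^esub> w" for w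
        using w h_le CS attained u unfolding h_le[OF u(1) w(1)] by (metis subsetD)
      have "supremum_in S C u"
        using u v CS h_le least by (auto simp: supremum_in_def subset_iff)
      then show ?thesis
        using attained by blast
    qed
  qed
  then show ?thesis by blast
qed

section \<open>Regular profinite tree sets as systems of bipartitions\<close>

theorem theorem4p5:
  fixes \<tau> :: "'a sep_system"
  assumes "tree_set \<tau>"
    and "regular \<tau>"
    and "profinite TYPE('p) TYPE('b) \<tau>"
  shows "bipartition_map \<tau> \<in> carrier \<tau> \<rightarrow> carrier (bipartitions (splitting_orientations \<tau>))
    \<and> tree_set_iso \<tau>
        (induced (bipartitions (splitting_orientations \<tau>)) (bipartition_map \<tau> ` carrier \<tau>))
        (bipartition_map \<tau>)"
proof -
  obtain h :: "'a \<Rightarrow> 'p \<Rightarrow> 'b" where "coordinatized_tree_set \<tau> h"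
    using profinite_coordinatized[OF assms] by blast
  then interpret coordinatized_tree_set \<tau> h .
  have into: "bipartition_map \<tau> \<in> carrier \<tau> \<rightarrow> carrier (bipartitions (splitting_orientations \<tau>))"
    using bipartition_map_carrier by blast
  show ?thesis
  proof (rule conjI[OF into tree_set_iso_image[OF assms(1) separation_system_bipartitions into]])
    show "bipartition_map \<tau> (sep_inv \<tau> s) =
        sep_inv (bipartitions (splitting_orientations \<tau>)) (bipartition_map \<tau> s)"
      if "s \<in> carrier \<tau>" for s
      using inv_inv[OF that] by (simp add: bipartition_map_def bipartitions_def)
    show "bipartition_map \<tau> r \<sqsubseteq>\<^bsub>bipartitions (splitting_orientations \<tau>)\<^esub> bipartition_map \<tau> s
        \<longleftrightarrow> r \<sqsubseteq>\<^bsub>\<tau>\<^esub> s" if "r \<in> carrier \<tau>" "s \<in> carrier \<tau>" for r s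
      using bipartition_map_le_iff[OF that] by (simp add: bipartition_map_def bipartitions_def)
  qed
qed

end
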